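(* If $s$ is odd, then the first and last letters of any $u_s$-saturated sequence are different.
   Context: Two sequences are isomorphic if one is obtained from the other by a one-to-one renaming of letters. A sequence contains a copy of $u$ if some (not necessarily contiguous) subsequence of it is isomorphic to $u$; otherwise it is $u$-free. A sequence is $2$-sparse if no two adjacent letters are equal. For an integer $s\ge 0$, $u_s=xyxy\dots$ is the alternating sequence on two distinct letters $x,y$ of length $s+2$. A sequence on a given alphabet is $u_s$-saturated if it is $2$-sparse, $u_s$-free, and adding any letter from the alphabet to an arbitrary position in the sequence (including the beginning or the end) violates $2$-sparsity or induces a copy of $u_s$.
   Formalization: The alphabet is assumed to contain at least two distinct letters; over a one-letter alphabet {a} the sequence consisting of the single letter a is u_s-saturated and its first and last letters coincide, so the claim fails there. *)

theory Defs
  imports Main "HOL-Library.Sublist"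
begin

definition isomorphic :: "'b list \<Rightarrow> 'a list \<Rightarrow> bool" where
  "isomorphic u v \<longleftrightarrow> (\<exists>f. inj_on f (set u) \<and> v = map f u)"

definition contains_copy :: "'a list \<Rightarrow> 'b list \<Rightarrow> bool" where
  "contains_copy w u \<longleftrightarrow> (\<exists>v. subseq v w \<and> isomorphic u v)"

abbreviation free_of :: "'b list \<Rightarrow> 'a list \<Rightarrow> bool" where
  "free_of u w \<equiv> \<not> contains_copy w u"

text \<open>
  The sequence \<open>u\<^sub>s = xyxy\<dots>\<close> of length \<open>s + 2\<close>. Only its isomorphism class matters, so the
  letters are chosen to be \<open>x = 0\<close> and \<open>y = 1\<close>.
\<close>
definition alt_seq :: "nat \<Rightarrow> nat list" where
  "alt_seq s = map (\<lambda>i. if even i then 0 else 1) [0..<s + 2]"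

text \<open>
  2-sparsity is \<^const>\<open>distinct_adj\<close>. Inserting the letter \<open>a\<close> at an arbitrary position, ends
  included, turns \<open>w = p @ q\<close> into \<open>p @ a # q\<close>, where \<open>p\<close> or \<open>q\<close> may be empty.
\<close>
definition saturated :: "nat \<Rightarrow> 'a set \<Rightarrow> 'a list \<Rightarrow> bool" where
  "saturated s A w \<longleftrightarrow>
     set w \<subseteq> A \<and> distinct_adj w \<and> free_of (alt_seq s) w \<and>
     (\<forall>a\<in>A. \<forall>p q. w = p @ q \<longrightarrow>
        \<not> distinct_adj (p @ a # q) \<or> contains_copy (p @ a # q) (alt_seq s))"

end

theory Submission imports Defs begin

text \<open>
  Since \<open>s\<close> is odd, the forbidden pattern has odd length and so begins and ends with the same
  letter. Suppose a saturated sequence begins and ends with \<open>x\<close>, and let \<open>y\<close> be its second letter.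
  Putting another \<open>y\<close> in front keeps the sequence 2-sparse, so it must create an alternation
  \<open>y b y \<dots> y\<close> that uses the new \<open>y\<close>; the remainder \<open>b y \<dots> b y\<close> already lies in the sequence. Each
  choice of \<open>b\<close> lets this remainder be extended to a forbidden alternation of the sequence itself:
  \<^item> If \<open>b\<close> is not \<open>x\<close>, the remainder starts after the second letter, which can therefore take
    the place of the new \<open>y\<close>.
  \<^item> If \<open>b\<close> is \<open>x\<close>, the remainder has even length and ends in \<open>y\<close>, hence before the last letter
    \<open>x\<close>, which extends it to \<open>x y \<dots> x y x\<close>.

  The sequences of length at most one, which have no second letter, are not saturated: they
  admit a further letter because the pattern has length at least three.
\<close>

text \<open>
  Swapping the two letters in the recursion exposes the first letter of an alternation, so that
  subsequence statements about it can be decided from the left.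
\<close>
fun alternation :: "'a \<Rightarrow> 'a \<Rightarrow> nat \<Rightarrow> 'a list" where
  "alternation a b 0 = []"
| "alternation a b (Suc n) = a # alternation b a n"

lemma length_alternation [simp]: "length (alternation a b n) = n"
  by (induction n arbitrary: a b) auto

lemma alternation_snoc:
  "alternation a b (Suc n) = alternation a b n @ [if even n then a else b]"
  by (induction n arbitrary: a b) auto

lemma map_parity_eq_alternation:
  "map (\<lambda>i. if even i then a else b) [0..<n] = alternation a b n"
proof (induction n)
  case (Suc n)
  then show ?case by (simp add: alternation_snoc del: alternation.simps)
qed simp

text \<open>
  The pattern always has length at least two, so both of its letters occur in it and an injective
  renaming is just a choice of two distinct letters.
\<close>
lemma contains_copy_alt_seq_iff:
  "contains_copy w (alt_seq s) \<longleftrightarrow> (\<exists>a b. a \<noteq> b \<and> subseq (alternation a b (s + 2)) w)"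
proof
  have map_alt: "map f (alt_seq s) = alternation (f 0) (f 1) (s + 2)" for f :: "nat \<Rightarrow> 'a"
    unfolding alt_seq_def map_parity_eq_alternation[symmetric] by simp
  have in_set: "0 \<in> set (alt_seq s)" "1 \<in> set (alt_seq s)"
    unfolding alt_seq_def map_parity_eq_alternation by simp_all
  {
    assume "contains_copy w (alt_seq s)"
    then obtain f where f: "inj_on f (set (alt_seq s))" "subseq (map f (alt_seq s)) w"
      unfolding contains_copy_def isomorphic_def by blast
    have "f 0 \<noteq> f 1"
      using inj_onD[OF f(1) _ in_set] by auto
    with f(2) show "\<exists>a b. a \<noteq> b \<and> subseq (alternation a b (s + 2)) w"
      unfolding map_alt by blast
  next
    assume "\<exists>a b. a \<noteq> b \<and> subseq (alternation a b (s + 2)) w"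
    then obtain a b where ab: "a \<noteq> b" "subseq (alternation a b (s + 2)) w"
      by blast
    let ?f = "\<lambda>i::nat. if i = 0 then a else b"
    have "set (alt_seq s) \<subseteq> {0, 1}"
      unfolding alt_seq_def by auto
    with ab(1) have "inj_on ?f (set (alt_seq s))"
      by (auto simp: inj_on_def)
    moreover have "subseq (map ?f (alt_seq s)) w"
      using ab(2) unfolding map_alt by simp
    ultimately show "contains_copy w (alt_seq s)"
      unfolding contains_copy_def isomorphic_def by blast
  }
qed

lemma contains_copy_alt_seq_length:
  assumes "contains_copy w (alt_seq s)"
  shows "s + 2 \<le> length w"
  using assms list_emb_length by (fastforce simp: contains_copy_alt_seq_iff)

text \<open>
  A word of length at most one can be prefixed with any letter that it does not contain: the result
  is 2-sparse and, having length at most two, too short for the pattern.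
\<close>
lemma saturated_length_ge_2:
  assumes "s > 0" and "\<exists>x\<in>A. \<exists>y\<in>A. x \<noteq> y" and sat: "saturated s A w"
  shows "2 \<le> length w"
proof (rule ccontr)
  assume short: "\<not> 2 \<le> length w"
  obtain c where c: "c \<in> A" "w \<noteq> [] \<longrightarrow> c \<noteq> hd w"
    using assms(2) by metis
  moreover have "w = [] \<or> w = [hd w]"
    using short by (cases w) (auto simp: not_less_eq_eq)
  ultimately have "distinct_adj ([] @ c # w)"
    by (metis append_Nil distinct_adj_Cons_Cons distinct_adj_singleton list.distinct(1))
  with sat c(1) have "contains_copy ([] @ c # w) (alt_seq s)"
    unfolding saturated_def by blast
  from contains_copy_alt_seq_length[OF this] short \<open>s > 0\<close> show False
    by simp
qed

text \<open>
  An even alternation ends in its second letter, so it cannot use a final occurrence of the first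
  letter, which is thus free to prolong it.
\<close>
lemma subseq_alternation_extend_last:
  assumes "subseq (alternation a b n) w" and "even n" and "a \<noteq> b"
    and "w \<noteq> []" and "last w = a"
  shows "subseq (alternation a b (Suc n)) w"
proof -
  have w: "w = butlast w @ [a]"
    using assms(4,5) by (metis append_butlast_last_id)
  have "subseq (alternation a b n) (butlast w)"
  proof (cases n)
    case (Suc m)
    then have snoc: "alternation a b n = alternation a b m @ [b]"
      using \<open>even n\<close> by (simp add: alternation_snoc del: alternation.simps)
    have "subseq (alternation a b m @ [b]) (butlast w @ [a])"
      using assms(1) w snoc by simp
    then obtain us vs where uv: "alternation a b m @ [b] = us @ vs"
      "subseq us (butlast w)" "subseq vs [a]"
      unfolding subseq_append_iff by blast
    have "vs = []"
      using uv(1,3) \<open>a \<noteq> b\<close> by (cases vs rule: rev_cases) (auto dest: list_emb_set)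
    with uv(1,2) show ?thesis
      by (simp only: snoc) simp
  qed simp
  then have "subseq (alternation a b n @ [a]) (butlast w @ [a])"
    by simp
  with w \<open>even n\<close> show ?thesis
    by (simp add: alternation_snoc del: alternation.simps)
qed

theorem lemma2p11:
  fixes s :: nat and A :: "'a set" and w :: "'a list"
  assumes "odd s"
    and "\<exists>x\<in>A. \<exists>y\<in>A. x \<noteq> y"
    and "saturated s A w"
  shows "hd w \<noteq> last w"
proof
  assume ends: "hd w = last w"
  have "2 \<le> length w"
    using saturated_length_ge_2[OF odd_pos[OF assms(1)] assms(2,3)] .
  then obtain x y r where w: "w = x # y # r"
    by (metis Suc_le_length_iff numeral_2_eq_2)
  have sparse: "distinct_adj w" and "y \<in> A"
    using assms(3) w unfolding saturated_def by auto
  then have "x \<noteq> y" and "distinct_adj ([] @ y # w)"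
    using w by auto
  then have "contains_copy (y # w) (alt_seq s)"
    using assms(3) \<open>y \<in> A\<close> unfolding saturated_def by (metis append_Nil)
  then obtain a b where ab: "a \<noteq> b" "subseq (alternation a b (s + 2)) (y # w)"
    unfolding contains_copy_alt_seq_iff by blast
  have free: "\<not> subseq (alternation c d (s + 2)) w" if "c \<noteq> d" for c d
    using that assms(3) unfolding saturated_def contains_copy_alt_seq_iff by blast
  have "a = y" and rest: "subseq (alternation b y (Suc s)) w"
    using ab free[OF ab(1)] by (auto split: if_splits)
  show False
  proof (cases "b = x")
    case True
    have "subseq (alternation x y (Suc (Suc s))) w"
      by (rule subseq_alternation_extend_last)
        (use rest True assms(1) \<open>x \<noteq> y\<close> ends w in auto)
    with free[OF \<open>x \<noteq> y\<close>] show False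
      by simp
  next
    case False
    \<comment> \<open>\<open>b\<close> differs from both leading letters, so the match cannot start before \<open>r\<close>\<close>
    have "subseq (alternation b y (Suc s)) r"
      using rest False ab(1) \<open>a = y\<close> unfolding w by simp
    then have "subseq (alternation y b (s + 2)) w"
      unfolding w using \<open>x \<noteq> y\<close> by simp
    with free[of y b] ab(1) \<open>a = y\<close> show False
      by simp
  qed
qed

end
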